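(* Let $\varphi_0$ be an $m\times m$ matrix of functions on $\mathbb{Z}^2$ solving the discrete matrix Riemann equation $$\varphi_{,1}-\varphi=(\varphi_{,1}-\varphi_{,0})\,\varphi .$$ Let $\boldsymbol{U}$ ($m\times n$) and $\boldsymbol{V}$ ($n\times m$) be matrices of functions on $\mathbb{Z}^2$ solving the linear equations $$\boldsymbol{U}_{,1}-\boldsymbol{U}+\boldsymbol{U}_{,0}\,\boldsymbol{A}=\big((\varphi_0)_{,1}-\varphi_0\big)\,\boldsymbol{U},$$ $$\boldsymbol{B}\,\boldsymbol{V}_{,-0}=\boldsymbol{V}\,\varphi_0,\qquad \boldsymbol{V}_{,1}-\boldsymbol{V}=\boldsymbol{V}_{,1}\,(\varphi_0)_{,0},$$ with constant $n\times n$ matrices $\boldsymbol{A},\boldsymbol{B}$. Let $$\tilde{\boldsymbol{X}}(k_0,k_1)=\boldsymbol{F}(k_0)-\begin{cases}\sum_{j=0}^{k_1-1}\boldsymbol{V}(k_0,j+1)\,\boldsymbol{U}(k_0+1,j)&\text{if }k_1\ge1,\\[4pt] \sum_{j=k_1-1}^{0}\boldsymbol{V}(k_0,j+1)\,\boldsymbol{U}(k_0+1,j)&\text{if }k_1<1,\end{cases}$$ where $\boldsymbol{F}$ is an arbitrary $n\times n$ matrix function of $k_0$ satisfying $$\boldsymbol{F}(k_0+1)\,\boldsymbol{A}-\boldsymbol{B}\,\boldsymbol{F}(k_0)-\boldsymbol{V}(k_0+1,0)\,\boldsymbol{U}(k_0+1,0)=0 .$$ Assume that $\tilde{\boldsymbol{X}}$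 is invertible. Then a new solution of the discrete matrix Riemann equation $\varphi_{,1}-\varphi=(\varphi_{,1}-\varphi_{,0})\,\varphi$ is given by $$\varphi=\varphi_0+\boldsymbol{U}\,(\tilde{\boldsymbol{X}}^{-1}\boldsymbol{V})_{,-0} .$$
   Context: All matrices of functions have entries that are functions of the discrete variables $(k_0,k_1)\in\mathbb{Z}^2$. For a (matrix) function $f$ on $\mathbb{Z}^2$: $f_{,0}(k_0,k_1)=f(k_0+1,k_1)$, $f_{,1}(k_0,k_1)=f(k_0,k_1+1)$, $f_{,-0}(k_0,k_1)=f(k_0-1,k_1)$. "Constant" means independent of $k_0$ and $k_1$. Here $m,n$ are positive integers.
   Formalization: Two formulas are corrected, as the claim fails otherwise: the equation for U has (φ_0)_{,1} − (φ_0)_{,0} in place of (φ_0)_{,1} − φ_0, and for k_1 < 1 the sum in X̃ is replaced by minus the sum from j = k_1 to −1, so that X̃(k_0,0) = F(k_0). *)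

theory Defs
  imports "HOL-Analysis.Analysis"
begin

text \<open>
  A matrix function on the lattice is a term of type \<open>int \<Rightarrow> int \<Rightarrow> 'a ^ 'c ^ 'r\<close>, with arguments
  \<open>k0\<close>, \<open>k1\<close>; the type \<open>'a ^ 'c ^ 'r\<close> has \<open>'r\<close> rows and \<open>'c\<close> columns.  The three operators below
  are the shifts \<open>f_{,0}\<close>, \<open>f_{,1}\<close> and \<open>f_{,-0}\<close>.
\<close>

definition shift0 :: "(int \<Rightarrow> int \<Rightarrow> 'b) \<Rightarrow> int \<Rightarrow> int \<Rightarrow> 'b" where
  "shift0 f = (\<lambda>k0 k1. f (k0 + 1) k1)"

definition shift1 :: "(int \<Rightarrow> int \<Rightarrow> 'b) \<Rightarrow> int \<Rightarrow> int \<Rightarrow> 'b" where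
  "shift1 f = (\<lambda>k0 k1. f k0 (k1 + 1))"

definition shift_minus0 :: "(int \<Rightarrow> int \<Rightarrow> 'b) \<Rightarrow> int \<Rightarrow> int \<Rightarrow> 'b" where
  "shift_minus0 f = (\<lambda>k0 k1. f (k0 - 1) k1)"

definition discrete_matrix_Riemann ::
    "(int \<Rightarrow> int \<Rightarrow> 'a::field ^ 'm ^ 'm) \<Rightarrow> bool" where
  "discrete_matrix_Riemann \<phi> \<longleftrightarrow>
     (\<forall>k0 k1. shift1 \<phi> k0 k1 - \<phi> k0 k1 = (shift1 \<phi> k0 k1 - shift0 \<phi> k0 k1) ** \<phi> k0 k1)"

text \<open>
  The sum that defines \<open>X\<close> is oriented: for \<open>k1 < 1\<close>, where the limits of the sum from \<open>0\<close> to
  \<open>k1 - 1\<close> are in reversed order, it stands for minus the sum from \<open>k1\<close> to \<open>-1\<close>, so that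
  \<open>X k0 0 = F k0\<close> and \<open>X_{,1} - X = - V_{,1} U_{,0}\<close> on all of the lattice.  An ordinary
  sum from \<open>k1 - 1\<close> to \<open>0\<close> in this case breaks this recursion, and with it the
  solution-generating result.
\<close>

definition Xtilde ::
    "(int \<Rightarrow> 'a::field ^ 'n ^ 'n) \<Rightarrow> (int \<Rightarrow> int \<Rightarrow> 'a ^ 'm ^ 'n) \<Rightarrow> (int \<Rightarrow> int \<Rightarrow> 'a ^ 'n ^ 'm)
      \<Rightarrow> int \<Rightarrow> int \<Rightarrow> 'a ^ 'n ^ 'n" where
  "Xtilde F V U k0 k1 = F k0 -
     (if k1 \<ge> 1 then (\<Sum>j\<in>{0..k1 - 1}. V k0 (j + 1) ** U (k0 + 1) j)
      else - (\<Sum>j\<in>{k1..-1}. V k0 (j + 1) ** U (k0 + 1) j))"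

text \<open>
  The coefficient in the linear equation for \<open>U\<close> has to be the difference of the two shifts,
  \<open>(\<phi>\<^sub>0)_{,1} - (\<phi>\<^sub>0)_{,0}\<close>, as in the Riemann equation itself.  With the unshifted
  \<open>\<phi>\<^sub>0\<close> in place of \<open>(\<phi>\<^sub>0)_{,0}\<close>, the new \<open>\<phi>\<close> is in
  general not a solution.
\<close>

end

(*
  Write Y = X_{,-0}, W = V_{,-0} and q = Y^{-1} W, so that the new field is \<phi>\<^sub>0 + U q.  The linear
  equations make Y satisfy Y_{,1} = Y - W_{,1} U and Y_{,0} A = B Y + W_{,0} U, which translate into
  q_{,1} - q = q_{,1} (\<phi>\<^sub>0 + U q) and A q = q_{,0} (\<phi>\<^sub>0 + U q).  Multiplied by U_{,1} and U_{,0} from the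
  left, these two add up to the Riemann equation for \<phi>\<^sub>0 + U q.
*)
theory Submission
  imports Defs
begin

lemma matrix_add_rdistrib: "(X + Y) ** Z = X ** Z + Y ** Z"
  for X Y :: "'a::semiring_1 ^ 'b ^ 'c" and Z :: "'a ^ 'd ^ 'b"
  by (simp add: matrix_matrix_mult_def vec_eq_iff distrib_right sum.distrib)

lemma matrix_diff_ldistrib: "X ** (Y - Z) = X ** Y - X ** Z"
  for X :: "'a::ring_1 ^ 'b ^ 'c" and Y Z :: "'a ^ 'd ^ 'b"
  by (simp add: matrix_matrix_mult_def vec_eq_iff right_diff_distrib sum_subtractf)

lemma matrix_diff_rdistrib: "(X - Y) ** Z = X ** Z - Y ** Z"
  for X Y :: "'a::ring_1 ^ 'b ^ 'c" and Z :: "'a ^ 'd ^ 'b"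
  by (simp add: matrix_matrix_mult_def vec_eq_iff left_diff_distrib sum_subtractf)

lemmas matrix_ring_simps =
  matrix_add_ldistrib matrix_add_rdistrib matrix_diff_ldistrib matrix_diff_rdistrib matrix_mul_assoc

lemma invertible_matrix_inv:
  fixes X :: "'a::semiring_1 ^ 'n ^ 'm"
  assumes "invertible X"
  shows "X ** matrix_inv X = mat 1" "matrix_inv X ** X = mat 1"
  using someI_ex[OF assms[unfolded invertible_def]] by (simp_all add: matrix_inv_def)

lemma invertible_mult_left_cancel:
  fixes X :: "'a::semiring_1 ^ 'n ^ 'm" and Y Z :: "'a ^ 'd ^ 'n"
  assumes "invertible X" "X ** Y = X ** Z"
  shows "Y = Z"
  by (metis assms invertible_matrix_inv(2) matrix_mul_assoc matrix_mul_lid)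

lemma matrix_inv_mult_eq:
  fixes X :: "'a::semiring_1 ^ 'n ^ 'm" and Y :: "'a ^ 'd ^ 'm"
  assumes "invertible X"
  shows "X ** (matrix_inv X ** Y) = Y"
  by (simp add: matrix_mul_assoc invertible_matrix_inv(1)[OF assms])

lemma Xtilde_0: "Xtilde F V U k0 0 = F k0"
  by (simp add: Xtilde_def)

text \<open>The orientation of the sum makes one recursion valid on both sides of the origin: for
  \<open>k1 \<ge> 0\<close> the new summand is the top one, while for \<open>k1 < 0\<close> the
  bottom summand \<open>j = k1\<close> leaves a sum that enters with the opposite sign.\<close>

lemma Xtilde_shift1:
  "Xtilde F V U k0 (k1 + 1) = Xtilde F V U k0 k1 - V k0 (k1 + 1) ** U (k0 + 1) k1"
proof (cases "k1 \<ge> 0")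
  case True
  then have "{0..k1} = insert k1 {0..k1 - 1}"
    by auto
  with True show ?thesis
    \<comment> \<open>At \<open>k1 = 0\<close> the two sides come from different branches of
      \<open>Xtilde\<close>; the right-hand one has the empty sum over
      \<open>{0..-1}\<close>.\<close>
    by (cases "k1 = 0") (simp_all add: Xtilde_def algebra_simps)
next
  case False
  then have "{k1..-1} = insert k1 {k1 + 1..-1}"
    by auto
  with False show ?thesis
    by (simp add: Xtilde_def algebra_simps)
qed

text \<open>\<open>F_eq\<close> is this relation at \<open>k1 = 0\<close>, and the linear equations
  for \<open>U\<close> and \<open>V\<close> make the difference \<open>G\<close> of its two sides
  independent of \<open>k1\<close>.\<close>

lemma Xtilde_shift0:
  fixes \<phi>\<^sub>0 :: "int \<Rightarrow> int \<Rightarrow> 'a::field ^ 'm ^ 'm"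
    and U :: "int \<Rightarrow> int \<Rightarrow> 'a ^ 'n ^ 'm"
    and V :: "int \<Rightarrow> int \<Rightarrow> 'a ^ 'm ^ 'n"
    and A B :: "'a ^ 'n ^ 'n"
  assumes U_eq: "\<And>k0 k1. U k0 (k1 + 1) - U k0 k1 + U (k0 + 1) k1 ** A
                 = (\<phi>\<^sub>0 k0 (k1 + 1) - \<phi>\<^sub>0 (k0 + 1) k1) ** U k0 k1"
    and V_eq0: "\<And>k0 k1. B ** V k0 k1 = V (k0 + 1) k1 ** \<phi>\<^sub>0 (k0 + 1) k1"
    and V_eq1: "\<And>k0 k1. V k0 (k1 + 1) - V k0 k1 = V k0 (k1 + 1) ** \<phi>\<^sub>0 (k0 + 1) k1"
    and F_eq: "\<And>k0. F (k0 + 1) ** A = B ** F k0 + V (k0 + 1) 0 ** U (k0 + 1) 0"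
  shows "Xtilde F V U (k0 + 1) k1 ** A
       = B ** Xtilde F V U k0 k1 + V (k0 + 1) k1 ** U (k0 + 1) k1"
proof -
  define G where "G k = Xtilde F V U (k0 + 1) k ** A - B ** Xtilde F V U k0 k
                    - V (k0 + 1) k ** U (k0 + 1) k" for k
  have step: "G (k + 1) = G k" for k
  proof -
    let ?V1 = "V (k0 + 1) (k + 1)" and ?U = "U (k0 + 1) k"
    have U1: "U (k0 + 1) (k + 1) = ?U - U (k0 + 1 + 1) k ** A
        + (\<phi>\<^sub>0 (k0 + 1) (k + 1) - \<phi>\<^sub>0 (k0 + 1 + 1) k) ** ?U"
      using U_eq[of "k0 + 1" k] by (simp add: algebra_simps)
    have V: "V (k0 + 1) k = ?V1 - ?V1 ** \<phi>\<^sub>0 (k0 + 1 + 1) k"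
      using V_eq1[of "k0 + 1" k] by (simp add: algebra_simps)
    \<comment> \<open>The terms \<open>?V1 ** U (k0 + 1 + 1) k ** A\<close> cancel, and by
      \<open>V_eq0\<close> so do those with \<open>\<phi>\<^sub>0 (k0 + 1) (k + 1)\<close>. What
      remains of the \<open>V\<close>-terms is
      \<open>?V1 - ?V1 ** \<phi>\<^sub>0 (k0 + 1 + 1) k\<close>, which is
      \<open>V (k0 + 1) k\<close>, times \<open>?U\<close>.\<close>
    show ?thesis
      by (simp add: G_def Xtilde_shift1 U1 V V_eq0 matrix_ring_simps)
  qed
  have "G k = 0" for k
  proof (induction k rule: int_induct[where k = 0])
    case base
    show ?case by (simp add: G_def Xtilde_0 F_eq)
  next
    case (step1 i)
    then show ?case by (simp add: step)
  next
    case (step2 i)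
    then show ?case using step[of "i - 1"] by simp
  qed
  then show ?thesis
    by (simp add: G_def algebra_simps)
qed

text \<open>This is the purely algebraic part, free of \<open>V\<close>, \<open>F\<close> and the
  inverse. The new field is the right factor in both relations for \<open>q\<close>, so multiplying
  by it from the right removes the shifted \<open>q\<close> from \<open>U_{,0} q_{,0}\<close> and
  leaves \<open>U_{,0} A q\<close>, which the linear equation for \<open>U\<close> absorbs.\<close>

lemma discrete_matrix_Riemann_dressing:
  fixes \<phi> :: "int \<Rightarrow> int \<Rightarrow> 'a::field ^ 'm ^ 'm"
    and U :: "int \<Rightarrow> int \<Rightarrow> 'a ^ 'n ^ 'm"
    and q :: "int \<Rightarrow> int \<Rightarrow> 'a ^ 'm ^ 'n"
    and A :: "'a ^ 'n ^ 'n"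
  assumes "discrete_matrix_Riemann \<phi>"
    and U_eq: "\<And>k0 k1. U k0 (k1 + 1) - U k0 k1 + U (k0 + 1) k1 ** A
                 = (\<phi> k0 (k1 + 1) - \<phi> (k0 + 1) k1) ** U k0 k1"
    and q0: "\<And>k0 k1. A ** q k0 k1 = q (k0 + 1) k1 ** (\<phi> k0 k1 + U k0 k1 ** q k0 k1)"
    and q1: "\<And>k0 k1. q k0 (k1 + 1) - q k0 k1
                 = q k0 (k1 + 1) ** (\<phi> k0 k1 + U k0 k1 ** q k0 k1)"
  shows "discrete_matrix_Riemann (\<lambda>k0 k1. \<phi> k0 k1 + U k0 k1 ** q k0 k1)"
  unfolding discrete_matrix_Riemann_def shift0_def shift1_def
proof (intro allI)
  fix k0 k1
  define p where "p = \<phi> k0 k1"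
  define p0 where "p0 = \<phi> (k0 + 1) k1"
  define p1 where "p1 = \<phi> k0 (k1 + 1)"
  define u where "u = U k0 k1"
  define u0 where "u0 = U (k0 + 1) k1"
  define u1 where "u1 = U k0 (k1 + 1)"
  define r where "r = q k0 k1"
  define r0 where "r0 = q (k0 + 1) k1"
  define r1 where "r1 = q k0 (k1 + 1)"
  note defs = p_def p0_def p1_def u_def u0_def u1_def r_def r0_def r1_def
  have p: "p1 - p = (p1 - p0) ** p"
    using assms(1) by (simp add: discrete_matrix_Riemann_def shift0_def shift1_def defs)
  have u: "u1 - u + u0 ** A = (p1 - p0) ** u"
    using U_eq[of k0 k1] by (simp add: defs)
  have r: "A ** r = r0 ** (p + u ** r)" "r1 - r = r1 ** (p + u ** r)"
    using q0[of k0 k1] q1[of k0 k1] by (simp_all add: defs)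
  have "(p1 + u1 ** r1 - (p0 + u0 ** r0)) ** (p + u ** r)
      = (p1 - p0) ** p + (p1 - p0) ** u ** r
        + u1 ** (r1 ** (p + u ** r)) - u0 ** (r0 ** (p + u ** r))"
    by (simp add: matrix_ring_simps)
  \<comment> \<open>The rewriting runs from this expression back to the previous one: each of
    \<open>p\<close>, \<open>u\<close> and \<open>r\<close> has the simpler side on its
    left.\<close>
  also have "\<dots> = (p1 - p) + (u1 - u + u0 ** A) ** r + u1 ** (r1 - r) - u0 ** (A ** r)"
    by (simp only: p u r)
  also have "\<dots> = p1 + u1 ** r1 - (p + u ** r)"
    by (simp add: matrix_ring_simps)
  finally show "\<phi> k0 (k1 + 1) + U k0 (k1 + 1) ** q k0 (k1 + 1) - (\<phi> k0 k1 + U k0 k1 ** q k0 k1)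
      = (\<phi> k0 (k1 + 1) + U k0 (k1 + 1) ** q k0 (k1 + 1)
          - (\<phi> (k0 + 1) k1 + U (k0 + 1) k1 ** q (k0 + 1) k1)) ** (\<phi> k0 k1 + U k0 k1 ** q k0 k1)"
    by (simp add: defs)
qed

theorem proposition4p10:
  fixes \<phi>\<^sub>0 :: "int \<Rightarrow> int \<Rightarrow> 'a::field ^ 'm ^ 'm"
    and U :: "int \<Rightarrow> int \<Rightarrow> 'a ^ 'n ^ 'm"
    and V :: "int \<Rightarrow> int \<Rightarrow> 'a ^ 'm ^ 'n"
    and A B :: "'a ^ 'n ^ 'n"
    and F :: "int \<Rightarrow> 'a ^ 'n ^ 'n"
  assumes seed: "discrete_matrix_Riemann \<phi>\<^sub>0"
    and U_eq: "\<And>k0 k1. shift1 U k0 k1 - U k0 k1 + shift0 U k0 k1 ** A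
                 = (shift1 \<phi>\<^sub>0 k0 k1 - shift0 \<phi>\<^sub>0 k0 k1) ** U k0 k1"
    and V_eq0: "\<And>k0 k1. B ** shift_minus0 V k0 k1 = V k0 k1 ** \<phi>\<^sub>0 k0 k1"
    and V_eq1: "\<And>k0 k1. shift1 V k0 k1 - V k0 k1 = shift1 V k0 k1 ** shift0 \<phi>\<^sub>0 k0 k1"
    and F_eq: "\<And>k0. F (k0 + 1) ** A - B ** F k0 - V (k0 + 1) 0 ** U (k0 + 1) 0 = 0"
    and X_inv: "\<And>k0 k1. invertible (Xtilde F V U k0 k1)"
  shows "discrete_matrix_Riemann
           (\<lambda>k0 k1. \<phi>\<^sub>0 k0 k1 +
              U k0 k1 ** shift_minus0 (\<lambda>l0 l1. matrix_inv (Xtilde F V U l0 l1) ** V l0 l1) k0 k1)"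
proof -
  define X where "X = Xtilde F V U"
  \<comment> \<open>With the backward shift built in, \<open>q (k0 + 1) k1\<close> contains the
    inverse of \<open>X k0 k1\<close>, and \<open>q k0 (k1 + 1)\<close> that of
    \<open>X (k0 - 1) (k1 + 1)\<close>. These are the factors cancelled in the proofs of
    \<open>q0\<close> and \<open>q1\<close>.\<close>
  define q where "q k0 k1 = matrix_inv (X (k0 - 1) k1) ** V (k0 - 1) k1" for k0 k1
  have inv: "invertible (X k0 k1)" for k0 k1
    using X_inv by (simp add: X_def)
  have U: "U k0 (k1 + 1) - U k0 k1 + U (k0 + 1) k1 ** A
      = (\<phi>\<^sub>0 k0 (k1 + 1) - \<phi>\<^sub>0 (k0 + 1) k1) ** U k0 k1" for k0 k1
    using U_eq by (simp add: shift0_def shift1_def)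
  have V0: "B ** V k0 k1 = V (k0 + 1) k1 ** \<phi>\<^sub>0 (k0 + 1) k1" for k0 k1
    using V_eq0[of "k0 + 1" k1] by (simp add: shift_minus0_def)
  have V1: "V k0 (k1 + 1) - V k0 k1 = V k0 (k1 + 1) ** \<phi>\<^sub>0 (k0 + 1) k1" for k0 k1
    using V_eq1 by (simp add: shift0_def shift1_def)
  have F: "F (k0 + 1) ** A = B ** F k0 + V (k0 + 1) 0 ** U (k0 + 1) 0" for k0
    using F_eq[of k0] by (simp add: algebra_simps)
  have X0: "X k0 k1 ** A = B ** X (k0 - 1) k1 + V k0 k1 ** U k0 k1" for k0 k1
    using Xtilde_shift0[where F = F and U = U and V = V and \<phi>\<^sub>0 = \<phi>\<^sub>0 and A = A and B = B,
        OF U V0 V1 F, of "k0 - 1" k1] by (simp add: X_def)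
  have X1: "X (k0 - 1) (k1 + 1) = X (k0 - 1) k1 - V (k0 - 1) (k1 + 1) ** U k0 k1" for k0 k1
    using Xtilde_shift1[of F V U "k0 - 1" k1] by (simp add: X_def)
  have Xq: "X (k0 - 1) k1 ** q k0 k1 = V (k0 - 1) k1" for k0 k1
    unfolding q_def by (rule matrix_inv_mult_eq[OF inv])
  have q0: "A ** q k0 k1 = q (k0 + 1) k1 ** (\<phi>\<^sub>0 k0 k1 + U k0 k1 ** q k0 k1)" for k0 k1
  proof (rule invertible_mult_left_cancel[OF inv])
    have "X k0 k1 ** (A ** q k0 k1)
        = B ** (X (k0 - 1) k1 ** q k0 k1) + V k0 k1 ** U k0 k1 ** q k0 k1"
      by (simp add: X0 matrix_ring_simps)
    \<comment> \<open>Here \<open>B\<close> meets \<open>V (k0 - 1) k1\<close>, which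
      \<open>V0\<close> turns into \<open>V k0 k1 ** \<phi>\<^sub>0 k0 k1\<close>.\<close>
    also have "\<dots> = V k0 k1 ** (\<phi>\<^sub>0 k0 k1 + U k0 k1 ** q k0 k1)"
      using V0[of "k0 - 1" k1] by (simp add: Xq matrix_ring_simps)
    also have "\<dots> = X k0 k1 ** (q (k0 + 1) k1 ** (\<phi>\<^sub>0 k0 k1 + U k0 k1 ** q k0 k1))"
      using Xq[of "k0 + 1" k1] by (simp add: matrix_mul_assoc)
    finally show "X k0 k1 ** (A ** q k0 k1)
        = X k0 k1 ** (q (k0 + 1) k1 ** (\<phi>\<^sub>0 k0 k1 + U k0 k1 ** q k0 k1))" .
  qed
  have q1: "q k0 (k1 + 1) - q k0 k1 = q k0 (k1 + 1) ** (\<phi>\<^sub>0 k0 k1 + U k0 k1 ** q k0 k1)" for k0 k1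
  proof (rule invertible_mult_left_cancel[OF inv])
    let ?V1 = "V (k0 - 1) (k1 + 1)"
    \<comment> \<open>Only the mixed product of \<open>X (k0 - 1) (k1 + 1)\<close> with the
      unshifted \<open>q k0 k1\<close> is not covered by \<open>Xq\<close>; the recursion
      \<open>X1\<close> lowers its first factor to \<open>X (k0 - 1) k1\<close>.\<close>
    have "X (k0 - 1) (k1 + 1) ** (q k0 (k1 + 1) - q k0 k1)
        = ?V1 - (X (k0 - 1) k1 - ?V1 ** U k0 k1) ** q k0 k1"
      by (simp only: matrix_diff_ldistrib Xq flip: X1)
    also have "\<dots> = (?V1 - V (k0 - 1) k1) + ?V1 ** U k0 k1 ** q k0 k1"
      by (simp add: matrix_diff_rdistrib Xq)
    also have "\<dots> = ?V1 ** (\<phi>\<^sub>0 k0 k1 + U k0 k1 ** q k0 k1)"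
      using V1[of "k0 - 1" k1] by (simp add: matrix_ring_simps)
    also have "\<dots> = X (k0 - 1) (k1 + 1) ** (q k0 (k1 + 1) ** (\<phi>\<^sub>0 k0 k1 + U k0 k1 ** q k0 k1))"
      by (simp add: matrix_mul_assoc Xq)
    finally show "X (k0 - 1) (k1 + 1) ** (q k0 (k1 + 1) - q k0 k1)
        = X (k0 - 1) (k1 + 1) ** (q k0 (k1 + 1) ** (\<phi>\<^sub>0 k0 k1 + U k0 k1 ** q k0 k1))" .
  qed
  show ?thesis
    using discrete_matrix_Riemann_dressing[where U = U and q = q and A = A, OF seed U q0 q1]
    by (simp add: shift_minus0_def q_def X_def)
qed

end
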